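(* For every $n\ge1$, the number of ascent sequences of length $n$ avoiding the pattern $102$ is $(3^{n-1}+1)/2$.
   Context: An ascent sequence is a finite sequence $x_1x_2\ldots x_n$ of nonnegative integers with $x_1=0$ and $x_i\le \operatorname{asc}(x_1\ldots x_{i-1})+1$ for all $1<i\le n$, where $\operatorname{asc}(y_1\ldots y_k)$ is the number of indices $j$ with $y_j<y_{j+1}$. Avoiding $102$ means there are no indices $i_1<i_2<i_3$ with $x_{i_2}<x_{i_1}<x_{i_3}$. *)

theory Defs
  imports Complex_Main
begin

definition asc :: "nat list \<Rightarrow> nat" where
  "asc xs = card {j. Suc j < length xs \<and> xs ! j < xs ! Suc j}"

text \<open>Lists are indexed from 0, so entry \<open>xs ! i\<close> is preceded by exactly \<open>take i xs\<close>.\<close>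

definition ascent_sequence :: "nat list \<Rightarrow> bool" where
  "ascent_sequence xs \<longleftrightarrow>
     xs \<noteq> [] \<and> xs ! 0 = 0 \<and>
     (\<forall>i. 0 < i \<and> i < length xs \<longrightarrow> xs ! i \<le> asc (take i xs) + 1)"

definition avoids_102 :: "nat list \<Rightarrow> bool" where
  "avoids_102 xs \<longleftrightarrow>
     \<not> (\<exists>i j k. i < j \<and> j < k \<and> k < length xs \<and> xs ! j < xs ! i \<and> xs ! i < xs ! k)"

end

theory Submission
  imports Defs
begin

text \<open>
  Build the sequences letter by letter. Call an entry that is followed by a smaller one a descent top;
  a new last letter creates the pattern 102 iff it exceeds some descent top. A sequence without descent
  tops is weakly increasing with entries \<open>0, \<dots>, M\<close>, and it can be followed by any \<open>c \<le> M + 1\<close>;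
  for \<open>c < M\<close> the least descent top becomes \<open>c + 1\<close>. A sequence with least descent top \<open>m + 1\<close> can be
  followed by any \<open>c \<le> m + 1\<close>, and for \<open>c < m\<close> the least descent top drops to \<open>c + 1\<close>. Hence the numbers
  \<open>G k M\<close> and \<open>F k m\<close> of extensions by \<open>k\<close> letters depend only on \<open>M\<close> and \<open>m\<close>. Their
  recursions imply \<open>F k m = 2 G k (m + 1) - G k (m + 2)\<close>, which eliminates \<open>F\<close> and gives
  \<open>G k 1 = 3 ^ k\<close> and \<open>G (k + 1) 0 = G k 0 + 3 ^ k\<close>.
\<close>

section \<open>Descent tops and avoidance of 102\<close>

text \<open>The smaller entry may stand anywhere later, not only next to the top. Values suffice,
  since they alone restrict the next letter.\<close>

definition descent_tops :: "nat list \<Rightarrow> nat set" where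
  "descent_tops xs = {b. \<exists>i j. i < j \<and> j < length xs \<and> xs ! j < xs ! i \<and> b = xs ! i}"

lemma descent_tops_singleton [simp]: "descent_tops [x] = {}"
  by (auto simp: descent_tops_def)

lemma descent_tops_snoc:
  "descent_tops (xs @ [c]) = descent_tops xs \<union> {b \<in> set xs. c < b}" (is "?L = ?R")
proof (intro set_eqI iffI)
  fix b assume "b \<in> ?L"
  then obtain i j where ij: "i < j" "j < Suc (length xs)"
    "(xs @ [c]) ! j < (xs @ [c]) ! i" "b = (xs @ [c]) ! i"
    by (auto simp: descent_tops_def)
  show "b \<in> ?R"
  proof (cases "j = length xs")
    case True
    with ij show ?thesis by (auto simp: nth_append)
  next
    case False
    with ij have "j < length xs" by simp
    with ij show ?thesis by (auto simp: nth_append descent_tops_def)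
  qed
next
  fix b assume "b \<in> ?R"
  then show "b \<in> ?L"
  proof
    assume "b \<in> descent_tops xs"
    then obtain i j where "i < j" "j < length xs" "xs ! j < xs ! i" "b = xs ! i"
      by (auto simp: descent_tops_def)
    then show ?thesis
      unfolding descent_tops_def by (intro CollectI exI[of _ i] exI[of _ j]) (auto simp: nth_append)
  next
    assume "b \<in> {b \<in> set xs. c < b}"
    then obtain i where "i < length xs" "b = xs ! i" "c < b"
      by (auto simp: in_set_conv_nth)
    then show ?thesis
      unfolding descent_tops_def
      by (intro CollectI exI[of _ i] exI[of _ "length xs"]) (auto simp: nth_append)
  qed
qed

text \<open>In an occurrence of 102 the first two letters make the first one a descent top of the
  prefix before the third.\<close>

lemma avoids_102_iff_descent_tops:
  "avoids_102 xs \<longleftrightarrow> (\<forall>k < length xs. \<forall>b \<in> descent_tops (take k xs). xs ! k \<le> b)"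
proof -
  have "descent_tops (take k xs) = {b. \<exists>i j. i < j \<and> j < k \<and> xs ! j < xs ! i \<and> b = xs ! i}"
    if "k < length xs" for k
    using that unfolding descent_tops_def by (intro Collect_cong ex_cong1 conj_cong) auto
  then show ?thesis
    unfolding avoids_102_def by (simp del: not_less flip: not_less) blast
qed

lemma avoids_102_snoc:
  "avoids_102 (xs @ [c]) \<longleftrightarrow> avoids_102 xs \<and> (\<forall>b \<in> descent_tops xs. c \<le> b)"
  by (auto simp: avoids_102_iff_descent_tops nth_append less_Suc_eq)

lemma asc_singleton [simp]: "asc [x] = 0"
  by (simp add: asc_def)

lemma asc_snoc:
  assumes "xs \<noteq> []"
  shows "asc (xs @ [c]) = asc xs + (if last xs < c then 1 else 0)"
proof -
  let ?A = "{j. Suc j < length xs \<and> xs ! j < xs ! Suc j}"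
  have "{j. Suc j < length (xs @ [c]) \<and> (xs @ [c]) ! j < (xs @ [c]) ! Suc j}
      = ?A \<union> (if last xs < c then {length xs - 1} else {})" (is "?L = ?R")
  proof (intro set_eqI)
    fix j
    consider "Suc j < length xs" | "length xs = Suc j" | "Suc j > length xs" by linarith
    then show "j \<in> ?L \<longleftrightarrow> j \<in> ?R"
      using assms by cases (auto simp: nth_append last_conv_nth)
  qed
  moreover have "finite ?A" by (rule finite_subset[of _ "{..<length xs}"]) auto
  moreover have "length xs - 1 \<notin> ?A" by auto
  ultimately show ?thesis by (simp add: asc_def)
qed

lemma ascent_sequence_snoc:
  assumes "xs \<noteq> []"
  shows "ascent_sequence (xs @ [c]) \<longleftrightarrow> ascent_sequence xs \<and> c \<le> asc xs + 1"
  using assms by (auto simp: ascent_sequence_def nth_append less_Suc_eq)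

section \<open>Extending admissible words letter by letter\<close>

definition good :: "nat list \<Rightarrow> bool" where
  "good xs \<longleftrightarrow> ascent_sequence xs \<and> avoids_102 xs"

lemma good_singleton_iff: "good [x] \<longleftrightarrow> x = 0"
  by (auto simp: good_def ascent_sequence_def avoids_102_def)

lemma good_snoc:
  assumes "xs \<noteq> []"
  shows "good (xs @ [c]) \<longleftrightarrow> good xs \<and> c \<le> asc xs + 1 \<and> (\<forall>b \<in> descent_tops xs. c \<le> b)"
  using assms by (auto simp: good_def ascent_sequence_snoc avoids_102_snoc)

text \<open>Closure under prefixes is what allows extensions to be split by their first
  letter.\<close>

lemma good_appendD: "good (xs @ ys) \<Longrightarrow> xs \<noteq> [] \<Longrightarrow> good xs"
  by (induction ys rule: rev_induct) (auto simp: good_snoc simp flip: append_assoc)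

definition extensions :: "nat \<Rightarrow> nat list \<Rightarrow> nat list set" where
  "extensions k xs = {ys. length ys = k \<and> good (xs @ ys)}"

lemma extensions_0: "good xs \<Longrightarrow> extensions 0 xs = {[]}"
  by (auto simp: extensions_def)

lemma extensions_Suc:
  "extensions (Suc k) xs = (\<Union>c \<in> {c. good (xs @ [c])}. (#) c ` extensions k (xs @ [c]))"
proof (intro set_eqI)
  fix ys
  show "ys \<in> extensions (Suc k) xs \<longleftrightarrow>
    ys \<in> (\<Union>c \<in> {c. good (xs @ [c])}. (#) c ` extensions k (xs @ [c]))"
    using good_appendD[of "xs @ [hd ys]" "tl ys"]
    by (cases ys) (auto simp: extensions_def)
qed

lemma finite_good_snoc: "xs \<noteq> [] \<Longrightarrow> finite {c. good (xs @ [c])}"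
  by (rule finite_subset[of _ "{..asc xs + 1}"]) (auto simp: good_snoc)

lemma finite_extensions: "xs \<noteq> [] \<Longrightarrow> finite (extensions k xs)"
proof (induction k arbitrary: xs)
  case 0
  then show ?case by (simp add: extensions_def)
next
  case (Suc k)
  then show ?case by (simp add: extensions_Suc finite_good_snoc)
qed

lemma card_extensions_Suc:
  assumes "xs \<noteq> []"
  shows "card (extensions (Suc k) xs) = (\<Sum>c | good (xs @ [c]). card (extensions k (xs @ [c])))"
proof -
  have "card (extensions (Suc k) xs) = (\<Sum>c | good (xs @ [c]). card ((#) c ` extensions k (xs @ [c])))"
    unfolding extensions_Suc
    by (rule card_UN_disjoint) (use assms in \<open>auto simp: finite_good_snoc finite_extensions\<close>)
  then show ?thesis by (simp add: card_image)
qed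

section \<open>The two kinds of states and their transitions\<close>

text \<open>\<open>last xs = M\<close> makes a new letter \<open>Suc M\<close> an ascent, so that
  \<open>asc\<close> keeps pace with the maximum; \<open>set xs = {..M}\<close> supplies the descent
  top \<open>Suc c\<close> when some \<open>c < M\<close> is appended.\<close>

definition increasing_state :: "nat \<Rightarrow> nat list \<Rightarrow> bool" where
  "increasing_state M xs \<longleftrightarrow>
     good xs \<and> descent_tops xs = {} \<and> set xs = {..M} \<and> asc xs = M \<and> last xs = M"

text \<open>The shift by one reflects that a descent top is positive.
  \<open>Suc m \<le> asc xs\<close> makes the ascent bound weaker than the bound from descent tops;
  the subset condition supplies later tops.\<close>

definition descent_state :: "nat \<Rightarrow> nat list \<Rightarrow> bool" where
  "descent_state m xs \<longleftrightarrow>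
     good xs \<and> Suc m \<in> descent_tops xs \<and> (\<forall>b \<in> descent_tops xs. Suc m \<le> b) \<and>
     {..Suc m} \<subseteq> set xs \<and> Suc m \<le> asc xs"

lemma descent_state_nonempty: "descent_state m xs \<Longrightarrow> xs \<noteq> []"
  by (auto simp: descent_state_def)

lemma increasing_state_nonempty: "increasing_state M xs \<Longrightarrow> xs \<noteq> []"
  by (auto simp: increasing_state_def)

lemma good_snoc_descent_state:
  "descent_state m xs \<Longrightarrow> good (xs @ [c]) \<longleftrightarrow> c \<le> Suc m"
  using descent_state_nonempty[of m xs] by (fastforce simp: good_snoc descent_state_def)

lemma descent_state_snoc:
  assumes "descent_state m xs" "c \<le> Suc m"
  shows "descent_state (min c m) (xs @ [c])"
proof -
  have state: "Suc m \<in> descent_tops xs" "\<And>b. b \<in> descent_tops xs \<Longrightarrow> Suc m \<le> b"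
    "{..Suc m} \<subseteq> set xs" "Suc m \<le> asc xs"
    using assms(1) by (auto simp: descent_state_def)
  have xs: "xs \<noteq> []" and good: "good (xs @ [c])"
    using assms descent_state_nonempty good_snoc_descent_state by auto
  have "Suc (min c m) \<in> set xs"
    using state(3) by auto
  \<comment> \<open>For \<open>c < m\<close> the entry \<open>Suc c\<close> becomes a top; for
    \<open>c = m\<close> or \<open>c = Suc m\<close> the old top \<open>Suc m\<close>
    serves.\<close>
  then have "Suc (min c m) \<in> descent_tops (xs @ [c])"
    using state(1) by (cases "c < m") (auto simp: descent_tops_snoc min_def)
  moreover have "Suc (min c m) \<le> b" if "b \<in> descent_tops (xs @ [c])" for b
    using that state(2)[of b] by (auto simp: descent_tops_snoc)
  moreover have "{..Suc (min c m)} \<subseteq> set (xs @ [c])"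
    using state(3) by (force simp: subset_iff)
  moreover have "Suc (min c m) \<le> asc (xs @ [c])"
    using state(4) xs by (simp add: asc_snoc)
  ultimately show ?thesis
    using good by (simp add: descent_state_def)
qed

lemma good_snoc_increasing_state:
  "increasing_state M xs \<Longrightarrow> good (xs @ [c]) \<longleftrightarrow> c \<le> Suc M"
  using increasing_state_nonempty[of M xs] by (auto simp: good_snoc increasing_state_def)

lemma increasing_state_snoc:
  assumes "increasing_state M xs" "c = M \<or> c = Suc M"
  shows "increasing_state c (xs @ [c])"
proof -
  have "xs \<noteq> []" "good (xs @ [c])"
    using assms increasing_state_nonempty good_snoc_increasing_state by auto
  then show ?thesis
    using assms by (auto simp: increasing_state_def descent_tops_snoc asc_snoc)
qed

lemma increasing_state_snoc_descent:
  assumes "increasing_state M xs" "c < M"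
  shows "descent_state c (xs @ [c])"
proof -
  have "xs \<noteq> []" "good (xs @ [c])"
    using assms increasing_state_nonempty good_snoc_increasing_state by auto
  then show ?thesis
    using assms by (auto simp: increasing_state_def descent_state_def descent_tops_snoc asc_snoc)
qed

section \<open>Counting recursions and their solution\<close>

text \<open>The factor 2 stands for the letters \<open>m\<close> and \<open>Suc m\<close>, which
  both keep the state. Integer values permit the subtractions below.\<close>

primrec F :: "nat \<Rightarrow> nat \<Rightarrow> int" where
  "F 0 m = 1"
| "F (Suc k) m = 2 * F k m + (\<Sum>s<m. F k s)"

primrec G :: "nat \<Rightarrow> nat \<Rightarrow> int" where
  "G 0 M = 1"
| "G (Suc k) M = G k M + G k (Suc M) + (\<Sum>s<M. F k s)"

lemma card_extensions_descent_state:
  "descent_state m xs \<Longrightarrow> int (card (extensions k xs)) = F k m"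
proof (induction k arbitrary: m xs)
  case 0
  then show ?case by (simp add: extensions_0 descent_state_def)
next
  case (Suc k)
  have "{c. good (xs @ [c])} = {..<Suc (Suc m)}"
    using Suc.prems by (auto simp: good_snoc_descent_state)
  moreover have "int (card (extensions k (xs @ [c]))) = F k (min c m)" if "c \<le> Suc m" for c
    using Suc.IH descent_state_snoc[OF Suc.prems that] by blast
  ultimately show ?case
    by (simp add: card_extensions_Suc descent_state_nonempty[OF Suc.prems])
qed

lemma card_extensions_increasing_state:
  "increasing_state M xs \<Longrightarrow> int (card (extensions k xs)) = G k M"
proof (induction k arbitrary: M xs)
  case 0
  then show ?case by (simp add: extensions_0 increasing_state_def)
next
  case (Suc k)
  have "{c. good (xs @ [c])} = {..<Suc (Suc M)}"
    using Suc.prems by (auto simp: good_snoc_increasing_state)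
  moreover have "int (card (extensions k (xs @ [c]))) = G k c" if "c = M \<or> c = Suc M" for c
    using Suc.IH increasing_state_snoc[OF Suc.prems that] by blast
  moreover have "int (card (extensions k (xs @ [c]))) = F k c" if "c < M" for c
    using increasing_state_snoc_descent[OF Suc.prems that] card_extensions_descent_state by blast
  ultimately show ?case
    by (simp add: card_extensions_Suc increasing_state_nonempty[OF Suc.prems])
qed

text \<open>Each summand is \<open>G k (Suc s)\<close> minus the difference
  \<open>G k (Suc (Suc s)) - G k (Suc s)\<close>: the first part is an index shift, the second
  telescopes.\<close>

lemma sum_F_telescope:
  assumes "\<And>m. F k m = 2 * G k (Suc m) - G k (Suc (Suc m))"
  shows "(\<Sum>s<M. F k s) = G k M + (\<Sum>s<M. G k s) + G k 1 - G k 0 - G k (Suc M)"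
  by (induction M) (simp_all add: assms)

lemma F_eq_G: "F k m = 2 * G k (Suc m) - G k (Suc (Suc m))"
proof (induction k arbitrary: m)
  case 0
  show ?case by simp
next
  case (Suc k)
  \<comment> \<open>Here \<open>G (Suc k) M\<close> becomes
    \<open>2 * G k M + (\<Sum>s<M. G k s) + G k 1 - G k 0\<close>, and both sides reduce to the same
    combination of values of \<open>G k\<close>.\<close>
  show ?case by (simp add: sum_F_telescope[OF Suc] Suc)
qed

text \<open>At \<open>M = 1\<close> the only summand is \<open>F k 0 = 2 * G k 1 - G k 2\<close>,
  which cancels the term \<open>G k 2\<close> and leaves \<open>3 * G k 1\<close>.\<close>

lemma G_1: "G k 1 = 3 ^ k"
  by (induction k) (simp_all add: F_eq_G)

lemma G_0: "2 * G k 0 = 3 ^ k + 1"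
  by (induction k) (use G_1 in \<open>simp_all add: algebra_simps\<close>)

theorem theorem2p8:
  fixes n :: nat
  assumes "n \<ge> 1"
  shows "real (card {xs. length xs = n \<and> ascent_sequence xs \<and> avoids_102 xs})
    = (3 ^ (n - 1) + 1) / 2"
proof -
  obtain k where n: "n = Suc k" using assms by (cases n) auto
  have "{xs. length xs = n \<and> ascent_sequence xs \<and> avoids_102 xs} = extensions (Suc k) []"
    by (auto simp: extensions_def good_def n)
  \<comment> \<open>The first letter is forced to be 0, so counting starts in the increasing state
    with \<open>M = 0\<close>.\<close>
  also have "\<dots> = (#) 0 ` extensions k [0]"
    by (simp add: extensions_Suc good_singleton_iff)
  finally have "card {xs. length xs = n \<and> ascent_sequence xs \<and> avoids_102 xs}
      = card (extensions k [0])"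
    by (simp add: card_image)
  moreover have "increasing_state 0 [0]"
    by (auto simp: increasing_state_def good_singleton_iff)
  ultimately have "2 * int (card {xs. length xs = n \<and> ascent_sequence xs \<and> avoids_102 xs}) = 3 ^ k + 1"
    by (simp only: card_extensions_increasing_state G_0)
  then have "2 * real (card {xs. length xs = n \<and> ascent_sequence xs \<and> avoids_102 xs}) = 3 ^ k + 1"
    by (metis (mono_tags, lifting) of_int_1 of_int_add of_int_mult of_int_numeral of_int_of_nat_eq of_int_power)
  then show ?thesis by (simp add: n)
qed

end
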